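(* Let $\mathcal{V}$ be a topological vector space over the field $\mathbb{R}$ or $\mathbb{C}$ and $X$ a non-empty set. Denote by $F(X)$ the set of all complex-valued functions on $X$, and let $T:\mathcal{V}\to F(X)$ be a linear operator with the property that for all $x\in X$ the mapping $\mathcal{V}\ni\alpha\mapsto T(\alpha)(x)\in\mathbb{C}$ is continuous. Let $S=\{\alpha\in\mathcal{V}: T(\alpha)\text{ is unbounded on }X\}$. Then either $S=\emptyset$ or $S$ is a dense $G_\delta$ set in $\mathcal{V}$.
   Context: $F(X)$ is a vector space under pointwise operations. A $G_\delta$ set is a countable intersection of open sets. No completeness of $\mathcal{V}$ is assumed. *)

theory Defs
  imports "HOL-Analysis.Analysis" "HOL-Library.Function_Algebras"
begin

text \<open>The class \<open>topological_ab_group_add\<close> provides joint continuity of addition.  No separation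
  axiom is imposed.\<close>

locale topological_vector_space = vector_space scale
  for scale :: "'k :: {field, topological_space} \<Rightarrow> 'v :: topological_ab_group_add \<Rightarrow> 'v" +
  assumes continuous_scale: "continuous_on UNIV (\<lambda>(c, v). scale c v)"

text \<open>The complex-valued functions on a set \<open>X\<close>, each represented by its extension by zero to the
  ambient type.  In this representation the pointwise operations on \<open>X\<close> are the pointwise operations
  of the full function type (addition comes from \<open>HOL-Library.Function_Algebras\<close>), so linearity into
  this space is \<open>linear\<close> for the scalings below.\<close>

definition complex_functions :: "'x set \<Rightarrow> ('x \<Rightarrow> complex) set" where
  "complex_functions X = {f. \<forall>x. x \<notin> X \<longrightarrow> f x = 0}"

definition real_fun_scale :: "real \<Rightarrow> ('x \<Rightarrow> complex) \<Rightarrow> 'x \<Rightarrow> complex" where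
  "real_fun_scale c f = (\<lambda>x. complex_of_real c * f x)"

definition complex_fun_scale :: "complex \<Rightarrow> ('x \<Rightarrow> complex) \<Rightarrow> 'x \<Rightarrow> complex" where
  "complex_fun_scale c f = (\<lambda>x. c * f x)"

lemma vector_space_real_fun_scale: "vector_space real_fun_scale"
  by standard (auto simp: real_fun_scale_def fun_eq_iff algebra_simps)

lemma vector_space_complex_fun_scale: "vector_space complex_fun_scale"
  by standard (auto simp: complex_fun_scale_def fun_eq_iff algebra_simps)

lemma subspace_real_complex_functions:
  "module.subspace real_fun_scale (complex_functions X)"
proof -
  interpret vector_space real_fun_scale by (rule vector_space_real_fun_scale)
  show ?thesis
    by (auto simp: subspace_def complex_functions_def real_fun_scale_def)
qed

lemma subspace_complex_complex_functions:
  "module.subspace complex_fun_scale (complex_functions X)"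
proof -
  interpret vector_space complex_fun_scale by (rule vector_space_complex_fun_scale)
  show ?thesis
    by (auto simp: subspace_def complex_functions_def complex_fun_scale_def)
qed

end

theory Submission
  imports Defs
begin

text \<open>\<open>S\<close> is the intersection over \<open>n\<close> of the open sets \<open>\<Union>\<^bsub>x\<in>X\<^esub> {\<alpha>. n < \<bar>T \<alpha> x\<bar>}\<close>. No Baire category
  argument is needed for density: given \<open>\<alpha> \<in> S\<close> and a vector \<open>\<beta> \<notin> S\<close>, the whole open ray
  \<open>\<beta> + r \<alpha>\<close> with \<open>r > 0\<close> lies in \<open>S\<close>, because adding the bounded function \<open>T \<beta>\<close> to a nonzero multiple
  of the unbounded function \<open>T \<alpha>\<close> cannot make it bounded; and \<open>\<beta>\<close> is the endpoint of this ray.\<close>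

lemma gdelta_in_unbounded_image:
  fixes T :: "'v :: topological_space \<Rightarrow> 'x \<Rightarrow> 'a :: real_normed_vector"
  assumes "\<And>x. x \<in> X \<Longrightarrow> continuous_on UNIV (\<lambda>\<alpha>. T \<alpha> x)"
  shows "gdelta_in euclidean {\<alpha>. \<not> bounded (T \<alpha> ` X)}"
proof -
  \<comment> \<open>The union over \<open>X\<close> may be uncountable and is still open; only the
    intersection over the thresholds has to be countable, so these are natural numbers.\<close>
  define U where "U n = (\<Union>x\<in>X. {\<alpha>. real n < norm (T \<alpha> x)})" for n
  have "open (U n)" for n
    unfolding U_def by (intro open_UN ballI open_Collect_less continuous_intros assms)
  then have "gdelta_in euclidean (\<Inter>(range U))"
    by (intro gdelta_in_Inter) (auto intro: open_imp_gdelta_in)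
  moreover have "\<not> bounded (T \<alpha> ` X) \<longleftrightarrow> (\<forall>n. \<alpha> \<in> U n)" for \<alpha>
  proof -
    have "bounded (T \<alpha> ` X) \<longleftrightarrow> (\<exists>n. \<forall>x\<in>X. norm (T \<alpha> x) \<le> real n)"
    proof
      assume "bounded (T \<alpha> ` X)"
      then obtain b where b: "\<And>x. x \<in> X \<Longrightarrow> norm (T \<alpha> x) \<le> b"
        by (auto simp: bounded_iff)
      obtain n where "b \<le> real n"
        using real_arch_simple by blast
      with b show "\<exists>n. \<forall>x\<in>X. norm (T \<alpha> x) \<le> real n"
        by (meson order_trans)
    qed (auto simp: bounded_iff)
    then show ?thesis
      by (simp add: U_def not_le [symmetric])
  qed
  then have "{\<alpha>. \<not> bounded (T \<alpha> ` X)} = \<Inter>(range U)"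
    by auto
  ultimately show ?thesis
    by simp
qed

text \<open>Additivity and homogeneity for real scalars are common to the real and the complex case,
  and \<open>of_real\<close> embeds the reals in either field, so one argument serves both. The
  fixed \<alpha> supplies the direction of the ray; the set in the conclusion binds its own
  \<alpha>.\<close>

lemma closure_unbounded_image_eq_UNIV:
  fixes scale :: "'k :: real_normed_field \<Rightarrow> 'v :: topological_ab_group_add \<Rightarrow> 'v"
    and T :: "'v \<Rightarrow> 'x \<Rightarrow> 'a :: real_normed_vector"
  assumes "topological_vector_space scale"
    and add: "\<And>\<alpha> \<beta> x. T (\<alpha> + \<beta>) x = T \<alpha> x + T \<beta> x"
    and scale: "\<And>r \<alpha> x. T (scale (of_real r) \<alpha>) x = r *\<^sub>R T \<alpha> x"
    and unbounded: "\<not> bounded (T \<alpha> ` X)"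
  shows "closure {\<alpha>. \<not> bounded (T \<alpha> ` X)} = UNIV"
proof -
  interpret topological_vector_space scale by fact
  let ?S = "{\<alpha>. \<not> bounded (T \<alpha> ` X)}"
  have "\<beta> \<in> closure ?S" for \<beta>
  proof (cases "bounded (T \<beta> ` X)")
    case False
    then show ?thesis
      by (simp add: closure_subset [THEN subsetD])
  next
    case True
    define ray where "ray r = \<beta> + scale (of_real r) \<alpha>" for r
    have "continuous_on UNIV (\<lambda>r. scale (of_real r) \<alpha>)"
      by (rule continuous_on_compose2[OF continuous_scale, of UNIV "\<lambda>r. (of_real r, \<alpha>)", simplified])
        (intro continuous_intros)
    then have cont: "continuous_on UNIV ray"
      unfolding ray_def by (intro continuous_intros)
    have "ray r \<in> ?S" if "r > 0" for r
    proof
      show "\<not> bounded (T (ray r) ` X)"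
      proof
        assume "bounded (T (ray r) ` X)"
        \<comment> \<open>Solving \<open>ray r\<close> = \<beta> + r \<alpha> for \<alpha> and
          applying \<open>T\<close> writes \<open>T \<alpha>\<close> as a multiple of a difference
          of two bounded functions; r > 0 permits the division.\<close>
        then have "bounded ((\<lambda>x. inverse r *\<^sub>R (T (ray r) x - T \<beta> x)) ` X)"
          using bounded_scaling[OF bounded_minus_comp[OF _ True], of "T (ray r)" "inverse r"]
          by (simp add: image_image)
        also have "(\<lambda>x. inverse r *\<^sub>R (T (ray r) x - T \<beta> x)) = T \<alpha>"
          using that by (simp add: ray_def add scale)
        finally show False
          using unbounded by simp
      qed
    qed
    then have "ray ` {0<..} \<subseteq> closure ?S"
      by (intro order_trans[OF _ closure_subset] image_subsetI) simp
    \<comment> \<open>A continuous map that sends a set into a closed set also sends its closure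
      there. This brings in the endpoint r = 0, where the ray equals \<beta>.\<close>
    then have "ray ` closure {0<..} \<subseteq> closure ?S"
      by (intro image_closure_subset continuous_on_subset[OF cont]) simp_all
    moreover have "ray 0 = \<beta>"
      by (simp add: ray_def)
    moreover have "(0::real) \<in> closure {0<..}"
      by simp
    ultimately show ?thesis
      by (metis image_subset_iff)
  qed
  then show ?thesis
    by blast
qed

theorem proposition5p2:
  fixes rscale :: "real \<Rightarrow> 'v :: topological_ab_group_add \<Rightarrow> 'v"
    and cscale :: "complex \<Rightarrow> 'v \<Rightarrow> 'v"
    and X :: "'x set"
    and T :: "'v \<Rightarrow> 'x \<Rightarrow> complex"
    and S :: "'v set"
  assumes "X \<noteq> {}"
    and "\<And>\<alpha>. T \<alpha> \<in> complex_functions X"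
    and real_or_complex:
      "(topological_vector_space rscale \<and> Vector_Spaces.linear rscale real_fun_scale T) \<or>
       (topological_vector_space cscale \<and> Vector_Spaces.linear cscale complex_fun_scale T)"
    and "\<And>x. x \<in> X \<Longrightarrow> continuous_on UNIV (\<lambda>\<alpha>. T \<alpha> x)"
    and "S = {\<alpha>. \<not> bounded (T \<alpha> ` X)}"
  shows "S = {} \<or> (closure S = UNIV \<and> gdelta_in euclidean S)"
proof (cases "S = {}")
  case False
  then obtain \<alpha> where \<alpha>: "\<not> bounded (T \<alpha> ` X)"
    using assms(5) by blast
  from real_or_complex have "closure S = UNIV"
  proof (elim disjE conjE)
    assume tvs: "topological_vector_space rscale"
      and "Vector_Spaces.linear rscale real_fun_scale T"
    then interpret Vector_Spaces.linear rscale real_fun_scale T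
      by simp
    show ?thesis
      unfolding assms(5) using \<alpha>
      by (intro closure_unbounded_image_eq_UNIV[OF tvs])
        \<comment> \<open>Here \<open>of_real\<close> is the identity on the scalars, and
          \<open>scaleR\<close> on the complex values is multiplication by the embedded
          real.\<close>
        (simp_all add: add scale real_fun_scale_def scaleR_conv_of_real)
  next
    assume tvs: "topological_vector_space cscale"
      and "Vector_Spaces.linear cscale complex_fun_scale T"
    then interpret Vector_Spaces.linear cscale complex_fun_scale T
      by simp
    show ?thesis
      unfolding assms(5) using \<alpha>
      by (intro closure_unbounded_image_eq_UNIV[OF tvs])
        (simp_all add: add scale complex_fun_scale_def scaleR_conv_of_real)
  qed
  moreover have "gdelta_in euclidean S"
    unfolding assms(5) by (rule gdelta_in_unbounded_image) (rule assms(4))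
  ultimately show ?thesis
    by simp
qed simp

end
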